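(* Let $(\Omega,d)$ be a metric space, $Y$ a set, $h:Y\to[0,\infty)$ and $f:\Omega\times Y\to\mathbb{R}$, and consider the problem $$\text{Minimize (with respect to } x)\ f(x,y)\ \text{ subject to } h(y)=0 \text{ and } x\in\Omega.$$ Apply to this problem the Main Algorithm described in the context, with its Step 3 implemented by the Optimization Phase Algorithm of the context, and with Step 3 of the latter implemented by the algorithm MOA of the context. Suppose that the Assumptions A1, A2 and A3 given in the context hold. Let $\varepsilon_{\mathrm{feas}},\varepsilon_{\mathrm{dist}},\eta>0$ be given. Assume, in addition, that whenever $h(y_{k+1})\le\varepsilon_{\mathrm{feas}}$, MOA is executed until it finds an $\eta$-$(M,p)$-critical point for the problem of minimizing $f(x,y_{k+1})+\alpha\, d(x,x_k)^\nu$ subject to $x\in\Omega$. Then there exists an iteration index $k$ not larger than $$\frac{c_{\mathrm{feas}}}{\varepsilon_{\mathrm{feas}}}+\frac{c_{\mathrm{dist}}}{\varepsilon_{\mathrm{dist}}^{\nu}},$$ where $c_{\mathrm{feas}}$ only depends on $x_0,y_0,r,\theta_0,\beta,h_{\max}$ and $f_{\min}$, and $c_{\mathrm{dist}}$ only depends on $\alpha,x_0,y_0,r,\theta_0,\beta,h_{\max}$ and $f_{\min}$, such that (i) $h(y_{k+1})\le\varepsilon_{\mathrm{feas}}$ and $d(x_k,x_{k+1})\le\varepsilon_{\mathrm{dist}}$, and (ii) $x_{k+1}$ is $\eta$-$(M,p)$-critical for the problem of minimizing $f(x,y_{k+1})+\alpha\, d(x,x_k)^\nu$ (subject to $x\i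n\Omega$).
   Context: Merit function: for $x\in\Omega$, $y\in Y$, $\theta\in(0,1)$, $\Phi(x,y,\theta)=\theta f(x,y)+(1-\theta)h(y)$. Main Algorithm. Parameters and starting data: $x_0\in\Omega$, $y_0\in Y$, $\theta_0\in(0,1)$, $\nu>0$, $r\in(0,1)$, $\alpha>0$, $\beta>0$. For $k=0,1,2,\dots$: Step 1 (restoration). Define $y^{\mathrm{re}}_k\in Y$ such that $h(y^{\mathrm{re}}_k)\le r\,h(y_k)$ and $f(x_k,y^{\mathrm{re}}_k)\le f(x_k,y_k)+\beta h(y_k)$. Step 2 (penalty parameter). If $\Phi(x_k,y^{\mathrm{re}}_k,\theta_k)\le\Phi(x_k,y_k,\theta_k)+\frac{1-r}{2}\left(h(y^{\mathrm{re}}_k)-h(y_k)\right)$, set $\theta_{k+1}=\theta_k$. Otherwise set $$\theta_{k+1}=\frac{(1+r)\left(h(y_k)-h(y^{\mathrm{re}}_k)\right)}{2\left(f(x_k,y^{\mathrm{re}}_k)-f(x_k,y_k)+h(y_k)-h(y^{\mathrm{re}}_k)\right)}.$$ Step 3 (optimization). Compute $y_{k+1}\in Y$ and $x_{k+1}\in\Omega$ such that $f(x_{k+1},y_{k+1})\le f(x_k,y^{\mathrm{re}}_k)-\alpha\, d(x_k,x_{k+1})^\nu$ and $\Phi(x_{k+1},y_{k+1},\theta_{k+1})\le\Phi(x_k,y_k,\theta_{k+1})+\frac{1-r}{2}\left(h(y^{\mathrm{re}}_k)-h(y_k)\right)$. Optimization Phase Algorithm (implementation of Step 3 of the Main Algorithm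 at iteration $k$). Step 1. Choose $y_{k+1}\in Y$. Step 2. Define $F(x)=f(x,y_{k+1})+\alpha\, d(x,x_k)^\nu$ for $x\in\Omega$. Step 3. Applying the monotone algorithm MOA to the minimization of $F$ over $\Omega$, starting at $x_k$, compute $x_{\mathrm{trial}}\in\Omega$ such that $F(x_{\mathrm{trial}})\le F(x_k)$ and $x_{\mathrm{trial}}$ satisfies the stopping criterion used for MOA. Step 4. If $y_{k+1}=y^{\mathrm{re}}_k$, or if both $f(x_{\mathrm{trial}},y_{k+1})\le f(x_k,y^{\mathrm{re}}_k)-\alpha\, d(x_k,x_{\mathrm{trial}})^\nu$ and $\Phi(x_{\mathrm{trial}},y_{k+1},\theta_{k+1})\le\Phi(x_k,y_k,\theta_{k+1})+\frac{1-r}{2}\left(h(y^{\mathrm{re}}_k)-h(y_k)\right)$ hold, return $y_{k+1}$ and $x_{k+1}=x_{\mathrm{trial}}$. Step 5. Redefine $y_{k+1}=y^{\mathrm{re}}_k$ and go to Step 2. MOA (applied to a function $F:\Omega\to\mathbb{R}$ with a surrogate model $M:\Omega\times\Omega\to\mathbb{R}$ and $p+1>0$). Parameters $\sigma_{\min}>0$, $\gamma>0$; starting point $x_0\in\Omega$ (MOA's own iterates are denoted $x_j$, $j=0,1,2,\dots$; in the Optimization Phase Algorithm its starting point is the current main iterate $x_k$). For $j=0,1,2,\dots$: Step 1. Set $\ell\leftarrow1$ and choose $\sigma_{j,1}\in[0,1]$ such that $x\mapsto M(x_j,x)+\sigma_{j,1}d(x_j,x)^{p+1}$ is bounded below in $\Omega$.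 Step 2. Compute $x_{j,\ell}\in\Omega$, a solution of: minimize $M(x_j,x)+\sigma_{j,\ell}\,d(x_j,x)^{p+1}$ subject to $x\in\Omega$. Step 3. If $F(x_{j,\ell})\le F(x_j)-\gamma\, d(x_j,x_{j,\ell})^{p+1}$ does not hold, set $\sigma_{j,\ell+1}=\max\{\sigma_{\min},2\sigma_{j,\ell}\}$, $\ell\leftarrow\ell+1$ and go to Step 2. Step 4. Set $x_{j+1}=x_{j,\ell}$, $\sigma_j=\sigma_{j,\ell}$, and go to Step 1 with $j\leftarrow j+1$. Assumption A1. At Step 1 of the Main Algorithm, for all $k\ge0$ it is possible to compute, in finite time, $y^{\mathrm{re}}_k$ satisfying the two required inequalities. Assumption A2. There exist $h_{\max}>0$ and $f_{\min}\in\mathbb{R}$ such that $h(y)\le h_{\max}$ and $f(x,y)\ge f_{\min}$ for all $y\in Y$, $x\in\Omega$. Assumption A3 (on the model $M$ of each function $F$ to which MOA is applied): (1) $M(\bar x,\bar x)=F(\bar x)$ for all $\bar x\in\Omega$; (2) there exist $L\ge0$ and $p+1>0$ such that $F(x)\le M(\bar x,x)+L\,d(\bar x,x)^{p+1}$ for all $\bar x,x\in\Omega$; (3) there exists $\sigma\ge0$ such that, for each $\bar x\in\Omega$, $M(\bar x,x)+\sigma d(\bar x,x)^{p+1}$ is bounded below as a function of $x\in\Omega$; (4) for all $\bar x\in\Omega$ and $\sigma>0$ it is affordable to solve, up to some given precision, the problem of minimizing $M(\bar x,x)+\sigma d(\bar x,x)^{p+1}$ subject to $x\in\Omega$ (a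 computability requirement: the solutions called for in Step 2 of MOA can be computed). Definition. A point $\bar x\in\Omega$ is $\eta$-$(M,p)$-critical for the minimization of $F$ over $\Omega$ if there exist $\sigma\in[0,2L]$ and $z\in\Omega$ such that $d(\bar x,z)\le\eta$ and $z$ is a local minimizer of $x\mapsto M(\bar x,x)+\sigma d(\bar x,x)^{p+1}$ subject to $x\in\Omega$. *)

theory Defs
  imports "HOL-Analysis.Analysis"
begin

text \<open>
  A metric space is given by a carrier \<open>\<Omega>\<close> and a distance \<open>d\<close> (locale \<open>Metric_space\<close>). Functions on
  \<open>\<Omega>\<close> and \<open>Y\<close> are HOL functions of which only the values on the carriers matter. Real exponents are
  written with \<open>powr\<close>; all bases are distances and all exponents are positive, and
  \<open>0 powr a = 0\<close>.
\<close>

definition local_minimizer :: "'a set \<Rightarrow> ('a \<Rightarrow> 'a \<Rightarrow> real) \<Rightarrow> ('a \<Rightarrow> real) \<Rightarrow> 'a \<Rightarrow> bool" where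
  "local_minimizer \<Omega> d g z \<longleftrightarrow>
     z \<in> \<Omega> \<and> (\<exists>\<delta>>0. \<forall>w\<in>\<Omega>. d z w < \<delta> \<longrightarrow> g z \<le> g w)"

definition regularized_model ::
  "('a \<Rightarrow> 'a \<Rightarrow> real) \<Rightarrow> ('a \<Rightarrow> 'a \<Rightarrow> real) \<Rightarrow> real \<Rightarrow> 'a \<Rightarrow> real \<Rightarrow> 'a \<Rightarrow> real" where
  "regularized_model d M p xbar \<sigma> x = M xbar x + \<sigma> * d xbar x powr (p + 1)"

text \<open>The function \<open>F\<close> being minimized enters criticality only through its model \<open>M\<close>; \<open>L\<close> is the
  constant of the model assumption.\<close>

definition critical ::
  "'a set \<Rightarrow> ('a \<Rightarrow> 'a \<Rightarrow> real) \<Rightarrow> ('a \<Rightarrow> 'a \<Rightarrow> real) \<Rightarrow> real \<Rightarrow> real \<Rightarrow> real \<Rightarrow> 'a \<Rightarrow> bool" where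
  "critical \<Omega> d M p L \<eta> xbar \<longleftrightarrow> xbar \<in> \<Omega> \<and>
     (\<exists>\<sigma>\<in>{0..2 * L}. \<exists>z\<in>\<Omega>. d xbar z \<le> \<eta> \<and>
        local_minimizer \<Omega> d (regularized_model d M p xbar \<sigma>) z)"

text \<open>The affordability of the subproblems is a computability requirement and is not part of this
  predicate; the subproblem solutions that are actually used are part of an execution of MOA below.\<close>

definition model_assumption ::
  "'a set \<Rightarrow> ('a \<Rightarrow> 'a \<Rightarrow> real) \<Rightarrow> ('a \<Rightarrow> real) \<Rightarrow> ('a \<Rightarrow> 'a \<Rightarrow> real) \<Rightarrow> real \<Rightarrow> real \<Rightarrow> bool" where
  "model_assumption \<Omega> d F M p L \<longleftrightarrow>
     (\<forall>xbar\<in>\<Omega>. M xbar xbar = F xbar) \<and>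
     L \<ge> 0 \<and> p + 1 > 0 \<and>
     (\<forall>xbar\<in>\<Omega>. \<forall>x\<in>\<Omega>. F x \<le> M xbar x + L * d xbar x powr (p + 1)) \<and>
     (\<exists>\<sigma>\<ge>0. \<forall>xbar\<in>\<Omega>. bdd_below (regularized_model d M p xbar \<sigma> ` \<Omega>))"

text \<open>\<open>moa_inner xj \<sigma> x'\<close>: the inner loop of MOA at the iterate \<open>xj\<close>, entered with the
  regularization parameter \<open>\<sigma>\<close>, stops with the new iterate \<open>x'\<close>.\<close>

inductive moa_inner ::
  "'a set \<Rightarrow> ('a \<Rightarrow> 'a \<Rightarrow> real) \<Rightarrow> ('a \<Rightarrow> real) \<Rightarrow> ('a \<Rightarrow> 'a \<Rightarrow> real) \<Rightarrow> real \<Rightarrow> real \<Rightarrow> real \<Rightarrow>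
   'a \<Rightarrow> real \<Rightarrow> 'a \<Rightarrow> bool"
  for \<Omega> d F M p \<sigma>min \<gamma> xj where
  accept: "moa_inner \<Omega> d F M p \<sigma>min \<gamma> xj \<sigma> z"
    if "is_arg_min (regularized_model d M p xj \<sigma>) (\<lambda>x. x \<in> \<Omega>) z"
      and "F z \<le> F xj - \<gamma> * d xj z powr (p + 1)"
| reject: "moa_inner \<Omega> d F M p \<sigma>min \<gamma> xj \<sigma> x'"
    if "is_arg_min (regularized_model d M p xj \<sigma>) (\<lambda>x. x \<in> \<Omega>) z"
      and "\<not> F z \<le> F xj - \<gamma> * d xj z powr (p + 1)"
      and "moa_inner \<Omega> d F M p \<sigma>min \<gamma> xj (max \<sigma>min (2 * \<sigma>)) x'"

definition moa_step ::
  "'a set \<Rightarrow> ('a \<Rightarrow> 'a \<Rightarrow> real) \<Rightarrow> ('a \<Rightarrow> real) \<Rightarrow> ('a \<Rightarrow> 'a \<Rightarrow> real) \<Rightarrow> real \<Rightarrow> real \<Rightarrow> real \<Rightarrow>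
   'a \<Rightarrow> 'a \<Rightarrow> bool" where
  "moa_step \<Omega> d F M p \<sigma>min \<gamma> xj x' \<longleftrightarrow>
     (\<exists>\<sigma>\<in>{0..1}. bdd_below (regularized_model d M p xj \<sigma> ` \<Omega>) \<and>
        moa_inner \<Omega> d F M p \<sigma>min \<gamma> xj \<sigma> x')"

text \<open>\<open>moa_result stop start xt\<close>: MOA, started at \<open>start\<close>, can be run until it returns the iterate
  \<open>xt\<close>, which satisfies the stopping criterion \<open>stop\<close>.\<close>

definition moa_result ::
  "'a set \<Rightarrow> ('a \<Rightarrow> 'a \<Rightarrow> real) \<Rightarrow> ('a \<Rightarrow> real) \<Rightarrow> ('a \<Rightarrow> 'a \<Rightarrow> real) \<Rightarrow> real \<Rightarrow> real \<Rightarrow> real \<Rightarrow>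
   ('a \<Rightarrow> bool) \<Rightarrow> 'a \<Rightarrow> 'a \<Rightarrow> bool" where
  "moa_result \<Omega> d F M p \<sigma>min \<gamma> stop start xt \<longleftrightarrow>
     (moa_step \<Omega> d F M p \<sigma>min \<gamma>)\<^sup>*\<^sup>* start xt \<and>
     xt \<in> \<Omega> \<and> F xt \<le> F start \<and> stop xt"

definition merit :: "('a \<Rightarrow> 'y \<Rightarrow> real) \<Rightarrow> ('y \<Rightarrow> real) \<Rightarrow> 'a \<Rightarrow> 'y \<Rightarrow> real \<Rightarrow> real" where
  "merit f h x y \<theta> = \<theta> * f x y + (1 - \<theta>) * h y"

definition restored ::
  "'y set \<Rightarrow> ('a \<Rightarrow> 'y \<Rightarrow> real) \<Rightarrow> ('y \<Rightarrow> real) \<Rightarrow> real \<Rightarrow> real \<Rightarrow> 'a \<Rightarrow> 'y \<Rightarrow> 'y \<Rightarrow> bool" where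
  "restored Y f h r \<beta> xk yk yre \<longleftrightarrow>
     yre \<in> Y \<and> h yre \<le> r * h yk \<and> f xk yre \<le> f xk yk + \<beta> * h yk"

definition next_penalty ::
  "('a \<Rightarrow> 'y \<Rightarrow> real) \<Rightarrow> ('y \<Rightarrow> real) \<Rightarrow> real \<Rightarrow> 'a \<Rightarrow> 'y \<Rightarrow> 'y \<Rightarrow> real \<Rightarrow> real" where
  "next_penalty f h r xk yk yre \<theta> =
     (if merit f h xk yre \<theta> \<le> merit f h xk yk \<theta> + (1 - r) / 2 * (h yre - h yk) then \<theta>
      else (1 + r) * (h yk - h yre) / (2 * (f xk yre - f xk yk + h yk - h yre)))"

definition sufficient_descent ::
  "('a \<Rightarrow> 'a \<Rightarrow> real) \<Rightarrow> ('a \<Rightarrow> 'y \<Rightarrow> real) \<Rightarrow> ('y \<Rightarrow> real) \<Rightarrow> real \<Rightarrow> real \<Rightarrow> real \<Rightarrow>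
   'a \<Rightarrow> 'y \<Rightarrow> 'y \<Rightarrow> real \<Rightarrow> 'y \<Rightarrow> 'a \<Rightarrow> bool" where
  "sufficient_descent d f h \<nu> r \<alpha> xk yk yre \<theta>' y' x' \<longleftrightarrow>
     f x' y' \<le> f xk yre - \<alpha> * d xk x' powr \<nu> \<and>
     merit f h x' y' \<theta>' \<le> merit f h xk yk \<theta>' + (1 - r) / 2 * (h yre - h yk)"

definition opa_objective ::
  "('a \<Rightarrow> 'a \<Rightarrow> real) \<Rightarrow> ('a \<Rightarrow> 'y \<Rightarrow> real) \<Rightarrow> real \<Rightarrow> real \<Rightarrow> 'a \<Rightarrow> 'y \<Rightarrow> 'a \<Rightarrow> real" where
  "opa_objective d f \<nu> \<alpha> xk y x = f x y + \<alpha> * d x xk powr \<nu>"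

text \<open>\<open>opa_loop moa ok yre y y' x'\<close>: the Optimization Phase Algorithm, entered with the
  candidate \<open>y\<close>, returns \<open>y'\<close> and \<open>x'\<close>. Here \<open>moa y xt\<close> says that MOA applied to the objective of \<open>y\<close>
  can return \<open>xt\<close>, and \<open>ok y xt\<close> is the acceptance test for a candidate other than \<open>yre\<close>.\<close>

inductive opa_loop ::
  "('y \<Rightarrow> 'a \<Rightarrow> bool) \<Rightarrow> ('y \<Rightarrow> 'a \<Rightarrow> bool) \<Rightarrow> 'y \<Rightarrow> 'y \<Rightarrow> 'y \<Rightarrow> 'a \<Rightarrow> bool"
  for moa ok yre where
  return: "opa_loop moa ok yre y y xt"
    if "moa y xt" and "y = yre \<or> ok y xt"
| retry: "opa_loop moa ok yre y y' x'"
    if "moa y xt" and "\<not> (y = yre \<or> ok y xt)" and "opa_loop moa ok yre yre y' x'"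

text \<open>An execution of the Main Algorithm, its optimization step being implemented by the Optimization
  Phase Algorithm with MOA. The sequence \<open>yt\<close> records the candidates chosen at the start of the
  Optimization Phase Algorithm. At iteration \<open>k\<close>, MOA is applied to the objectives of at most two candidates,
  \<open>yt k\<close> and (if that one is rejected) \<open>yre k\<close>; the model \<open>M k y'\<close> with its constants \<open>p k y'\<close> and
  \<open>L k y'\<close>, and the stopping criterion \<open>stop k y'\<close>, are those used for the candidate \<open>y'\<close>.
  The inequalities that the Main Algorithm requires of its optimization step are not imposed on the result: they
  follow from the Optimization Phase Algorithm.\<close>

definition main_execution ::
  "'a set \<Rightarrow> ('a \<Rightarrow> 'a \<Rightarrow> real) \<Rightarrow> 'y set \<Rightarrow> ('a \<Rightarrow> 'y \<Rightarrow> real) \<Rightarrow> ('y \<Rightarrow> real) \<Rightarrow>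
   real \<Rightarrow> real \<Rightarrow> real \<Rightarrow> real \<Rightarrow> real \<Rightarrow> real \<Rightarrow>
   (nat \<Rightarrow> 'y \<Rightarrow> 'a \<Rightarrow> 'a \<Rightarrow> real) \<Rightarrow> (nat \<Rightarrow> 'y \<Rightarrow> real) \<Rightarrow> (nat \<Rightarrow> 'y \<Rightarrow> 'a \<Rightarrow> bool) \<Rightarrow>
   (nat \<Rightarrow> 'a) \<Rightarrow> (nat \<Rightarrow> 'y) \<Rightarrow> (nat \<Rightarrow> real) \<Rightarrow> (nat \<Rightarrow> 'y) \<Rightarrow> (nat \<Rightarrow> 'y) \<Rightarrow> bool" where
  "main_execution \<Omega> d Y f h \<nu> r \<alpha> \<beta> \<sigma>min \<gamma> M p stop x y \<theta> yre yt \<longleftrightarrow>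
     \<nu> > 0 \<and> r \<in> {0<..<1} \<and> \<alpha> > 0 \<and> \<beta> > 0 \<and> \<sigma>min > 0 \<and> \<gamma> > 0 \<and>
     x 0 \<in> \<Omega> \<and> y 0 \<in> Y \<and> \<theta> 0 \<in> {0<..<1} \<and>
     (\<forall>k. restored Y f h r \<beta> (x k) (y k) (yre k) \<and>
          \<theta> (Suc k) = next_penalty f h r (x k) (y k) (yre k) (\<theta> k) \<and>
          yt k \<in> Y \<and>
          opa_loop
            (\<lambda>y' xt. moa_result \<Omega> d (opa_objective d f \<nu> \<alpha> (x k) y') (M k y') (p k y')
                       \<sigma>min \<gamma> (stop k y') (x k) xt)
            (\<lambda>y' xt. sufficient_descent d f h \<nu> r \<alpha> (x k) (y k) (yre k) (\<theta> (Suc k)) y' xt)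
            (yre k) (yt k) (y (Suc k)) (x (Suc k)))"

definition moa_candidates :: "(nat \<Rightarrow> 'y) \<Rightarrow> (nat \<Rightarrow> 'y) \<Rightarrow> nat \<Rightarrow> 'y set" where
  \<comment> \<open>a second call of MOA at iteration \<open>k\<close> always determines \<open>y (Suc k)\<close>\<close>
  "moa_candidates y yt k = {yt k, y (Suc k)}"

text \<open>Existence of suitable restored points along the iterates; that they are computable in finite
  time has no counterpart here.\<close>

definition restoration_possible ::
  "'y set \<Rightarrow> ('a \<Rightarrow> 'y \<Rightarrow> real) \<Rightarrow> ('y \<Rightarrow> real) \<Rightarrow> real \<Rightarrow> real \<Rightarrow> (nat \<Rightarrow> 'a) \<Rightarrow> (nat \<Rightarrow> 'y) \<Rightarrow> bool" where
  "restoration_possible Y f h r \<beta> x y \<longleftrightarrow> (\<forall>k. \<exists>y'. restored Y f h r \<beta> (x k) (y k) y')"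

definition bounded_problem ::
  "'a set \<Rightarrow> 'y set \<Rightarrow> ('a \<Rightarrow> 'y \<Rightarrow> real) \<Rightarrow> ('y \<Rightarrow> real) \<Rightarrow> real \<Rightarrow> real \<Rightarrow> bool" where
  "bounded_problem \<Omega> Y f h hmax fmin \<longleftrightarrow>
     hmax > 0 \<and> (\<forall>y\<in>Y. h y \<le> hmax) \<and> (\<forall>x\<in>\<Omega>. \<forall>y\<in>Y. f x y \<ge> fmin)"

end

theory Submission
  imports Defs
begin

text \<open>
  The penalty parameters decrease but stay above a positive bound, so the descent of the merit
  function makes the infeasibilities \<open>h (y k)\<close> summable: dividing by \<open>\<theta>\<close>, the changes of the weight
  \<open>(1 - \<theta>) / \<theta>\<close> of \<open>h\<close> telescope, at a total cost proportional to \<open>hmax\<close>. As \<open>f\<close> increases at iteration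
  \<open>k\<close> by at most \<open>\<beta> * h (y k) - \<alpha> * d (x k) (x (Suc k)) powr \<nu>\<close>, the powers of the steps are summable
  as well. Both sums are bounded by constants, which limits the number of iterations at which
  \<open>h (y (Suc k)) > \<epsilon>feas\<close> or \<open>d (x k) (x (Suc k)) > \<epsilon>dist\<close>.
\<close>

section \<open>Update of the penalty parameter\<close>

text \<open>With \<open>A\<close> the change of \<open>f\<close> and \<open>D\<close> the decrease
  of \<open>h\<close> under restoration, the merit test reads
  \<open>\<theta> * (A + D) \<le> (1 + r) * D / 2\<close>, which is linear in
  \<open>\<theta>\<close>. The replacement value is the one giving equality.\<close>

lemma next_penalty_bounds:
  fixes h :: "'y \<Rightarrow> real"
  assumes "restored Y f h r \<beta> xk yk yre" "0 < r" "r < 1" "0 < \<beta>" "0 \<le> h yk" "0 \<le> h yre" "0 < \<theta>"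
  defines "\<theta>' \<equiv> next_penalty f h r xk yk yre \<theta>"
  shows "\<theta>' \<le> \<theta>"
    and "min \<theta> ((1 + r) * (1 - r) / (2 * (1 - r + \<beta>))) \<le> \<theta>'"
    and "merit f h xk yre \<theta>' \<le> merit f h xk yk \<theta>' + (1 - r) / 2 * (h yre - h yk)"
proof -
  define A where "A = f xk yre - f xk yk"
  define D where "D = h yk - h yre"
  have A: "A \<le> \<beta> * h yk" and D: "(1 - r) * h yk \<le> D"
    using assms(1) by (auto simp: A_def D_def restored_def algebra_simps)
  have merit_iff: "merit f h xk yre t \<le> merit f h xk yk t + (1 - r) / 2 * (h yre - h yk)
      \<longleftrightarrow> t * (A + D) \<le> (1 + r) * D / 2" for t
    by (simp add: merit_def A_def D_def field_simps)
  have \<theta>': "\<theta>' = (if \<theta> * (A + D) \<le> (1 + r) * D / 2 then \<theta> else (1 + r) * D / (2 * (A + D)))"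
    unfolding \<theta>'_def next_penalty_def merit_iff by (simp add: A_def D_def algebra_simps)
  have "\<theta>' \<le> \<theta> \<and> min \<theta> ((1 + r) * (1 - r) / (2 * (1 - r + \<beta>))) \<le> \<theta>' \<and>
    \<theta>' * (A + D) \<le> (1 + r) * D / 2"
  proof (cases "\<theta> * (A + D) \<le> (1 + r) * D / 2")
    case True
    then show ?thesis by (simp add: \<theta>')
  next
    case False
    \<comment> \<open>Since \<open>D \<ge> 0\<close>, failure of the test forces
      \<open>A + D > 0\<close>, so the quotient defining the new parameter is a genuine one.\<close>
    have "0 \<le> (1 - r) * h yk" using assms by simp
    with D have "0 \<le> D" by linarith
    then have "0 \<le> (1 + r) * D / 2" using assms by simp
    with False have "0 < \<theta> * (A + D)" by linarith
    then have AD: "0 < A + D" using \<open>0 < \<theta>\<close> by (simp add: zero_less_mult_iff)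
    \<comment> \<open>Eliminating \<open>h yk\<close> between the bounds on \<open>A\<close> and
      \<open>D\<close> gives \<open>(1 - r) * A \<le> \<beta> * D\<close>, hence a lower bound on
      \<open>D / (A + D)\<close> that does not depend on the iterate.\<close>
    have "(1 - r) * A \<le> (1 - r) * (\<beta> * h yk)" using A \<open>r < 1\<close> by (intro mult_left_mono) auto
    also have "\<dots> = \<beta> * ((1 - r) * h yk)" by simp
    also have "\<dots> \<le> \<beta> * D" using D \<open>0 < \<beta>\<close> by (intro mult_left_mono) auto
    finally have "(1 - r) * (A + D) \<le> (1 - r + \<beta>) * D" by (simp add: algebra_simps)
    then have "(1 - r) / (1 - r + \<beta>) \<le> D / (A + D)"
      using AD assms by (simp add: divide_simps mult_ac)
    then have "(1 + r) / 2 * ((1 - r) / (1 - r + \<beta>)) \<le> (1 + r) / 2 * (D / (A + D))"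
      using \<open>0 < r\<close> by (intro mult_left_mono) auto
    then have lower: "(1 + r) * (1 - r) / (2 * (1 - r + \<beta>)) \<le> (1 + r) * D / (2 * (A + D))"
      by (simp only: times_divide_times_eq)
    have scale: "(1 + r) * D / (2 * s) * s = (1 + r) * D / 2" if "0 < s" for s
      using that by simp
    have "(1 + r) * D / (2 * (A + D)) \<le> \<theta>"
      using AD False by (simp add: divide_simps mult_ac)
    moreover note lower scale[OF AD]
    moreover have "\<theta>' = (1 + r) * D / (2 * (A + D))" using False by (simp only: \<theta>' if_False)
    ultimately show ?thesis by (metis min.coboundedI2 order_refl)
  qed
  then show "\<theta>' \<le> \<theta>" and "min \<theta> ((1 + r) * (1 - r) / (2 * (1 - r + \<beta>))) \<le> \<theta>'"
    and "merit f h xk yre \<theta>' \<le> merit f h xk yk \<theta>' + (1 - r) / 2 * (h yre - h yk)"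
    unfolding merit_iff by auto
qed

section \<open>Outcome of the optimization phase\<close>

lemma opa_loop_result:
  assumes "opa_loop moa ok yre y y' x'"
  shows "moa y' x'" and "y' = y \<or> y' = yre" and "y' = yre \<or> ok y' x'"
  using assms by (induction rule: opa_loop.induct) auto

text \<open>The fallback candidate \<open>yre\<close> passes the acceptance test as well.\<close>

lemma sufficient_descent_restored:
  assumes "Metric_space \<Omega> d" "xk \<in> \<Omega>" "0 \<le> \<alpha>" "0 \<le> \<theta>"
    and "opa_objective d f \<nu> \<alpha> xk yre x' \<le> opa_objective d f \<nu> \<alpha> xk yre xk"
    and "merit f h xk yre \<theta> \<le> merit f h xk yk \<theta> + (1 - r) / 2 * (h yre - h yk)"
  shows "sufficient_descent d f h \<nu> r \<alpha> xk yk yre \<theta> yre x'"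
proof -
  interpret Metric_space \<Omega> d by fact
  have descent: "f x' yre \<le> f xk yre - \<alpha> * d xk x' powr \<nu>"
    using assms(2,5) by (simp add: opa_objective_def commute)
  also have "\<dots> \<le> f xk yre" using \<open>0 \<le> \<alpha>\<close> by simp
  finally have "\<theta> * f x' yre \<le> \<theta> * f xk yre" using \<open>0 \<le> \<theta>\<close> by (rule mult_left_mono)
  with descent assms(6) show ?thesis by (simp add: sufficient_descent_def merit_def)
qed

section \<open>Summation and counting for real sequences\<close>

text \<open>After division by \<open>\<theta> (Suc k)\<close>, both sides of the descent carry the
  weight \<open>\<rho> (Suc k)\<close> on \<open>H\<close>. Replacing it by \<open>\<rho> k\<close>
  on the right costs at most \<open>(\<rho> (Suc k) - \<rho> k) * hmax\<close>, and these costs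
  telescope because \<open>\<rho>\<close> is nondecreasing.\<close>

lemma weighted_descent_sum:
  fixes F H \<theta> :: "nat \<Rightarrow> real"
  assumes H: "\<And>k. 0 \<le> H k" "\<And>k. H k \<le> hmax"
    and \<theta>: "\<And>k. 0 < \<theta> k" "\<And>k. \<theta> k \<le> 1" "\<And>k. \<theta> (Suc k) \<le> \<theta> k"
    and "0 \<le> c"
    and descent: "\<And>k. \<theta> (Suc k) * F (Suc k) + (1 - \<theta> (Suc k)) * H (Suc k)
      \<le> \<theta> (Suc k) * F k + (1 - \<theta> (Suc k)) * H k - c * H k"
  shows "F n + c * (\<Sum>k<n. H k) \<le> F 0 + hmax / \<theta> n"
proof -
  define \<rho> where "\<rho> k = 1 / \<theta> k - 1" for k
  have \<rho>_nonneg: "0 \<le> \<rho> k" for k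
    using \<theta>(1,2)[of k] by (simp add: \<rho>_def)
  have \<rho>_mono: "\<rho> k \<le> \<rho> (Suc k)" for k
    using \<theta>(1)[of k] \<theta>(1)[of "Suc k"] \<theta>(3)[of k] by (simp add: \<rho>_def frac_le)
  have step: "F (Suc k) + \<rho> (Suc k) * H (Suc k) \<le> F k + \<rho> (Suc k) * H k - c * H k" for k
  proof -
    let ?t = "\<theta> (Suc k)"
    have t: "0 < ?t" "?t \<le> 1" using \<theta> by auto
    have t\<rho>: "1 - ?t = ?t * \<rho> (Suc k)" using t by (simp add: \<rho>_def field_simps)
    \<comment> \<open>Because \<open>?t \<le> 1\<close>, the decrease \<open>c * H k\<close>
      survives the division by \<open>?t\<close>.\<close>
    have "?t * (c * H k) \<le> 1 * (c * H k)"
      using t H \<open>0 \<le> c\<close> by (intro mult_right_mono) auto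
    with descent[of k] have "?t * (F (Suc k) + \<rho> (Suc k) * H (Suc k))
        \<le> ?t * (F k + \<rho> (Suc k) * H k - c * H k)"
      unfolding t\<rho> by (simp add: algebra_simps)
    then show ?thesis using t by simp
  qed
  \<comment> \<open>The term \<open>\<rho> n * H n\<close> is kept so that the induction closes; it
    is dropped afterwards.\<close>
  have "F n + \<rho> n * H n + c * (\<Sum>k<n. H k) \<le> F 0 + \<rho> n * hmax"
  proof (induction n)
    case 0
    show ?case using \<rho>_nonneg H by (simp add: mult_left_mono)
  next
    case (Suc n)
    have "(\<rho> (Suc n) - \<rho> n) * H n \<le> (\<rho> (Suc n) - \<rho> n) * hmax"
      using \<rho>_mono H by (intro mult_left_mono) auto
    with Suc step[of n] show ?case by (simp add: algebra_simps)
  qed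
  moreover have "0 \<le> \<rho> n * H n" using \<rho>_nonneg H by simp
  moreover have "\<rho> n * hmax \<le> hmax / \<theta> n"
    using H[of 0] by (simp add: \<rho>_def algebra_simps)
  ultimately show ?thesis by linarith
qed

text \<open>Markov's inequality for counting measure.\<close>

lemma card_ge_threshold_le:
  fixes g :: "'b \<Rightarrow> real"
  assumes "finite A" "\<And>k. k \<in> A \<Longrightarrow> 0 \<le> g k" "0 < e" "sum g A \<le> S"
  shows "card {k \<in> A. e \<le> g k} \<le> S / e"
proof -
  have "card {k \<in> A. e \<le> g k} * e = (\<Sum>k | k \<in> A \<and> e \<le> g k. e)" by simp
  also have "\<dots> \<le> (\<Sum>k | k \<in> A \<and> e \<le> g k. g k)" by (intro sum_mono) auto
  also have "\<dots> \<le> sum g A" using assms by (intro sum_mono2) auto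
  finally show ?thesis using assms by (simp add: field_simps)
qed

text \<open>By counting, at most \<open>S / e\<close> indices violate the first bound and at most
  \<open>T / e'\<close> the second, so they cannot cover all natural numbers up to the sum of these
  two quotients.\<close>

lemma exists_small_both:
  fixes a b :: "nat \<Rightarrow> real"
  assumes "\<And>k. 0 \<le> a k" "\<And>k. 0 \<le> b k" "0 < e" "0 < e'"
    and "\<And>n. (\<Sum>k<n. a k) \<le> S" "\<And>n. (\<Sum>k<n. b k) \<le> T"
  shows "\<exists>k. real k \<le> S / e + T / e' \<and> a k < e \<and> b k < e'"
proof (rule ccontr)
  assume contra: "\<not> ?thesis"
  define B where "B = S / e + T / e'"
  \<comment> \<open>The empty sums give \<open>0 \<le> S\<close> and \<open>0 \<le> T\<close>; thus
    \<open>nat\<close> does not truncate below, and \<open>n\<close>, the number of naturals up to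
    \<open>B\<close>, strictly exceeds \<open>B\<close>.\<close>
  have "0 \<le> B" using assms(3,4) assms(5,6)[of 0] by (simp add: B_def)
  define n where "n = Suc (nat \<lfloor>B\<rfloor>)"
  define P where "P = {k \<in> {..<n}. e \<le> a k}"
  define Q where "Q = {k \<in> {..<n}. e' \<le> b k}"
  have "{..<n} \<subseteq> P \<union> Q"
  proof
    fix k assume "k \<in> {..<n}"
    then have "k \<le> nat \<lfloor>B\<rfloor>" by (simp add: n_def)
    with \<open>0 \<le> B\<close> have "real k \<le> B" by linarith
    with contra \<open>k \<in> {..<n}\<close> show "k \<in> P \<union> Q"
      unfolding B_def P_def Q_def by force
  qed
  then have "card {..<n} \<le> card (P \<union> Q)"
    by (rule card_mono[rotated]) (simp add: P_def Q_def)
  also have "\<dots> \<le> card P + card Q"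
    by (rule card_Un_le)
  finally have "real n \<le> real (card P) + real (card Q)"
    by simp
  also have "\<dots> \<le> B"
    unfolding B_def P_def Q_def using assms by (intro add_mono card_ge_threshold_le) auto
  finally show False unfolding n_def by linarith
qed

section \<open>Invariants of an execution\<close>

lemma main_execution_step:
  assumes "Metric_space \<Omega> d" and h: "\<And>y. y \<in> Y \<Longrightarrow> h y \<ge> 0"
    and exec: "main_execution \<Omega> d Y f h \<nu> r \<alpha> \<beta> \<sigma>min \<gamma> M p stop x y \<theta> yre yt"
  shows "x k \<in> \<Omega>" and "y k \<in> Y" and "0 < \<theta> k" and "\<theta> (Suc k) \<le> \<theta> k"
    and "min (\<theta> 0) ((1 + r) * (1 - r) / (2 * (1 - r + \<beta>))) \<le> \<theta> k"
    and "stop k (y (Suc k)) (x (Suc k))"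
    and "sufficient_descent d f h \<nu> r \<alpha> (x k) (y k) (yre k) (\<theta> (Suc k)) (y (Suc k)) (x (Suc k))"
proof -
  let ?b = "(1 + r) * (1 - r) / (2 * (1 - r + \<beta>))"
  note ex = exec[unfolded main_execution_def]
  have par: "0 < r" "r < 1" "0 < \<alpha>" "0 < \<beta>" using ex by auto
  have b: "0 < ?b" using par by simp
  have re: "restored Y f h r \<beta> (x k) (y k) (yre k)" for k using ex by blast
  have \<theta>_Suc: "\<theta> (Suc k) = next_penalty f h r (x k) (y k) (yre k) (\<theta> k)" for k using ex by blast
  have yt: "yt k \<in> Y" and yre: "yre k \<in> Y" for k
    using ex re[of k] by (auto simp: restored_def)
  have "opa_loop
      (\<lambda>y' xt. moa_result \<Omega> d (opa_objective d f \<nu> \<alpha> (x k) y') (M k y') (p k y')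
                 \<sigma>min \<gamma> (stop k y') (x k) xt)
      (\<lambda>y' xt. sufficient_descent d f h \<nu> r \<alpha> (x k) (y k) (yre k) (\<theta> (Suc k)) y' xt)
      (yre k) (yt k) (y (Suc k)) (x (Suc k))" for k
    using ex by blast
  note opa = opa_loop_result[OF this]
  have moa: "x (Suc k) \<in> \<Omega>" "stop k (y (Suc k)) (x (Suc k))"
    "opa_objective d f \<nu> \<alpha> (x k) (y (Suc k)) (x (Suc k)) \<le> opa_objective d f \<nu> \<alpha> (x k) (y (Suc k)) (x k)"
    for k using opa(1)[of k] by (auto simp: moa_result_def)
  show x: "x k \<in> \<Omega>" for k using ex moa(1) by (cases k) auto
  show y: "y k \<in> Y" for k
  proof (cases k)
    case 0
    then show ?thesis using ex by blast
  next
    case (Suc j)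
    then show ?thesis using opa(2)[of j] yt[of j] yre[of j] by auto
  qed
  \<comment> \<open>Stated under \<open>0 < \<theta> k\<close>, since positivity comes only from the
    induction below, which uses the second bound and \<open>0 < ?b\<close>.\<close>
  have pen: "\<theta> (Suc k) \<le> \<theta> k" "min (\<theta> k) ?b \<le> \<theta> (Suc k)"
    "merit f h (x k) (yre k) (\<theta> (Suc k))
      \<le> merit f h (x k) (y k) (\<theta> (Suc k)) + (1 - r) / 2 * (h (yre k) - h (y k))"
    if "0 < \<theta> k" for k
    using next_penalty_bounds[OF re par(1,2,4) h[OF y] h[OF yre] that] by (simp_all add: \<theta>_Suc)
  have \<theta>: "0 < \<theta> k \<and> min (\<theta> 0) ?b \<le> \<theta> k" for k
  proof (induction k)
    case 0
    show ?case using ex by auto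
  next
    case (Suc k)
    then show ?case using pen(2)[of k] b by linarith
  qed
  then show pos: "0 < \<theta> k" and "min (\<theta> 0) ?b \<le> \<theta> k" for k by auto
  show "\<theta> (Suc k) \<le> \<theta> k" by (intro pen(1) pos)
  show "stop k (y (Suc k)) (x (Suc k))" by (rule moa(2))
  show "sufficient_descent d f h \<nu> r \<alpha> (x k) (y k) (yre k) (\<theta> (Suc k)) (y (Suc k)) (x (Suc k))"
  \<comment> \<open>The fallback candidate is returned without a test, so its descent has to be
    derived; any other candidate has passed the test.\<close>
  proof (cases "y (Suc k) = yre k")
    case True
    have "sufficient_descent d f h \<nu> r \<alpha> (x k) (y k) (yre k) (\<theta> (Suc k)) (yre k) (x (Suc k))"
      using moa(3)[of k] pen(3)[OF pos] pos[of "Suc k"] par True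
      by (intro sufficient_descent_restored[OF assms(1) x]) auto
    with True show ?thesis by simp
  next
    case False
    then show ?thesis using opa(3)[of k] by blast
  qed
qed

section \<open>Explicit constants and the iteration bound\<close>

definition penalty_bound :: "real \<Rightarrow> real \<Rightarrow> real \<Rightarrow> real" where
  "penalty_bound r \<theta>0 \<beta> = min \<theta>0 ((1 + r) * (1 - r) / (2 * (1 - r + \<beta>)))"

text \<open>The witness for \<open>cfeas\<close>: the largest possible drop of \<open>f\<close> plus
  the cost of the weight changes, divided by the decrease rate
  \<open>(1 - r)\<^sup>2 / 2\<close>.\<close>

definition infeasibility_bound ::
  "('a \<Rightarrow> 'y \<Rightarrow> real) \<Rightarrow> 'a \<Rightarrow> 'y \<Rightarrow> real \<Rightarrow> real \<Rightarrow> real \<Rightarrow> real \<Rightarrow> real \<Rightarrow> real" where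
  "infeasibility_bound f x0 y0 r \<theta>0 \<beta> hmax fmin =
     2 / (1 - r)\<^sup>2 * (f x0 y0 - fmin + hmax / penalty_bound r \<theta>0 \<beta>)"

text \<open>The witness for \<open>cdist\<close>: the largest possible drop of \<open>f\<close> plus
  all increases of \<open>f\<close> allowed by restoration, divided by
  \<open>\<alpha>\<close>.\<close>

definition step_bound ::
  "('a \<Rightarrow> 'y \<Rightarrow> real) \<Rightarrow> real \<Rightarrow> 'a \<Rightarrow> 'y \<Rightarrow> real \<Rightarrow> real \<Rightarrow> real \<Rightarrow> real \<Rightarrow> real \<Rightarrow> real" where
  "step_bound f \<alpha> x0 y0 r \<theta>0 \<beta> hmax fmin =
     (f x0 y0 - fmin + \<beta> * infeasibility_bound f x0 y0 r \<theta>0 \<beta> hmax fmin) / \<alpha>"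

lemma main_execution_sums:
  assumes metric: "Metric_space \<Omega> d" and h: "\<And>y. y \<in> Y \<Longrightarrow> h y \<ge> 0"
    and exec: "main_execution \<Omega> d Y f h \<nu> r \<alpha> \<beta> \<sigma>min \<gamma> M p stop x y \<theta> yre yt"
    and bounded: "bounded_problem \<Omega> Y f h hmax fmin"
  shows "(\<Sum>k<n. h (y k)) \<le> infeasibility_bound f (x 0) (y 0) r (\<theta> 0) \<beta> hmax fmin" (is "_ \<le> ?S")
    and "(\<Sum>k<n. d (x k) (x (Suc k)) powr \<nu>)
      \<le> step_bound f \<alpha> (x 0) (y 0) r (\<theta> 0) \<beta> hmax fmin"
proof -
  note step = main_execution_step[OF metric h exec]
  note ex = exec[unfolded main_execution_def]
  have par: "0 < r" "r < 1" "0 < \<alpha>" "0 < \<beta>" "0 < \<theta> 0" "\<theta> 0 < 1" using ex by auto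
  have re: "restored Y f h r \<beta> (x k) (y k) (yre k)" for k using ex by blast
  have hmax: "h (y k) \<le> hmax" "0 < hmax" and fmin: "fmin \<le> f (x k) (y k)" for k
    using bounded step(1,2) by (auto simp: bounded_problem_def)
  have "\<theta> k \<le> 1" for k
  proof (induction k)
    case (Suc k)
    then show ?case using step(4)[of k] by simp
  qed (use par in simp)
  note \<theta> = step(3) this step(4)
  define \<theta>b where "\<theta>b = penalty_bound r (\<theta> 0) \<beta>"
  have \<theta>b: "0 < \<theta>b" "\<theta>b \<le> \<theta> k" for k
    using par step(5)[of k] by (auto simp: \<theta>b_def penalty_bound_def)
  have sum_h: "(\<Sum>k<n. h (y k)) \<le> ?S" for n
  proof -
    \<comment> \<open>One factor \<open>(1 - r) / 2\<close> comes from the merit condition, the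
      other \<open>1 - r\<close> from \<open>h (yre k) \<le> r * h (y k)\<close>.\<close>
    let ?c = "(1 - r)\<^sup>2 / 2"
    have "\<theta> (Suc k) * f (x (Suc k)) (y (Suc k)) + (1 - \<theta> (Suc k)) * h (y (Suc k))
      \<le> \<theta> (Suc k) * f (x k) (y k) + (1 - \<theta> (Suc k)) * h (y k) - ?c * h (y k)" for k
    proof -
      have "(1 - r) / 2 * (h (yre k) - h (y k)) \<le> (1 - r) / 2 * (- ((1 - r) * h (y k)))"
        using re[of k] par by (intro mult_left_mono) (auto simp: restored_def algebra_simps)
      also have "\<dots> = - (?c * h (y k))" by (simp add: power2_eq_square)
      finally show ?thesis using step(7)[of k]
        unfolding sufficient_descent_def merit_def by linarith
    qed
    from weighted_descent_sum[of "\<lambda>k. h (y k)" hmax \<theta> ?c "\<lambda>k. f (x k) (y k)" n, OF _ hmax(1) \<theta> _ this]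
    have "f (x n) (y n) + ?c * (\<Sum>k<n. h (y k)) \<le> f (x 0) (y 0) + hmax / \<theta> n"
      using h step(2) by simp
    moreover have "hmax / \<theta> n \<le> hmax / \<theta>b"
      using \<theta>b(1) \<theta>b(2)[of n] hmax by (intro divide_left_mono) auto
    ultimately have "?c * (\<Sum>k<n. h (y k)) \<le> f (x 0) (y 0) - fmin + hmax / \<theta>b"
      using fmin[of n] by linarith
    then have "2 / (1 - r)\<^sup>2 * (?c * (\<Sum>k<n. h (y k))) \<le> ?S"
      unfolding infeasibility_bound_def \<theta>b_def by (intro mult_left_mono) auto
    then show ?thesis using par by simp
  qed
  then show "(\<Sum>k<n. h (y k)) \<le> ?S" .
  have "f (x n) (y n) + \<alpha> * (\<Sum>k<n. d (x k) (x (Suc k)) powr \<nu>)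
      \<le> f (x 0) (y 0) + \<beta> * (\<Sum>k<n. h (y k))"
  proof (induction n)
    case (Suc n)
    then show ?case using step(7)[of n] re[of n]
      by (simp add: sufficient_descent_def restored_def algebra_simps)
  qed simp
  moreover have "\<beta> * (\<Sum>k<n. h (y k)) \<le> \<beta> * ?S" using sum_h par by simp
  ultimately have "\<alpha> * (\<Sum>k<n. d (x k) (x (Suc k)) powr \<nu>) \<le> f (x 0) (y 0) - fmin + \<beta> * ?S"
    using fmin[of n] by linarith
  then show "(\<Sum>k<n. d (x k) (x (Suc k)) powr \<nu>)
      \<le> step_bound f \<alpha> (x 0) (y 0) r (\<theta> 0) \<beta> hmax fmin"
    using par by (simp add: step_bound_def field_simps)
qed

theorem theorem6p1:
  fixes \<Omega> :: "'a set" and d :: "'a \<Rightarrow> 'a \<Rightarrow> real"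
    and Y :: "'y set" and h :: "'y \<Rightarrow> real" and f :: "'a \<Rightarrow> 'y \<Rightarrow> real"
  assumes "Metric_space \<Omega> d"
    and "\<And>y. y \<in> Y \<Longrightarrow> h y \<ge> 0"
  shows
    "\<exists>(cfeas :: 'a \<Rightarrow> 'y \<Rightarrow> real \<Rightarrow> real \<Rightarrow> real \<Rightarrow> real \<Rightarrow> real \<Rightarrow> real)
      (cdist :: real \<Rightarrow> 'a \<Rightarrow> 'y \<Rightarrow> real \<Rightarrow> real \<Rightarrow> real \<Rightarrow> real \<Rightarrow> real \<Rightarrow> real).
       \<forall>\<nu> r \<alpha> \<beta> \<sigma>min \<gamma> M p L stop x y \<theta> yre yt hmax fmin \<epsilon>feas \<epsilon>dist \<eta>.
         main_execution \<Omega> d Y f h \<nu> r \<alpha> \<beta> \<sigma>min \<gamma> M p stop x y \<theta> yre yt \<longrightarrow>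
         restoration_possible Y f h r \<beta> x y \<longrightarrow>
         bounded_problem \<Omega> Y f h hmax fmin \<longrightarrow>
         (\<forall>k. \<forall>y'\<in>moa_candidates y yt k.
            model_assumption \<Omega> d (opa_objective d f \<nu> \<alpha> (x k) y') (M k y') (p k y') (L k y')) \<longrightarrow>
         \<epsilon>feas > 0 \<longrightarrow> \<epsilon>dist > 0 \<longrightarrow> \<eta> > 0 \<longrightarrow>
         (\<forall>k. \<forall>y'\<in>moa_candidates y yt k. h y' \<le> \<epsilon>feas \<longrightarrow>
            (\<forall>z\<in>\<Omega>. stop k y' z \<longrightarrow> critical \<Omega> d (M k y') (p k y') (L k y') \<eta> z)) \<longrightarrow>
         (\<exists>k. real k \<le> cfeas (x 0) (y 0) r (\<theta> 0) \<beta> hmax fmin / \<epsilon>feas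
                     + cdist \<alpha> (x 0) (y 0) r (\<theta> 0) \<beta> hmax fmin / \<epsilon>dist powr \<nu> \<and>
              h (y (Suc k)) \<le> \<epsilon>feas \<and> d (x k) (x (Suc k)) \<le> \<epsilon>dist \<and>
              critical \<Omega> d (M k (y (Suc k))) (p k (y (Suc k))) (L k (y (Suc k))) \<eta> (x (Suc k)))"
proof (intro exI[of _ "infeasibility_bound f"] exI[of _ "step_bound f"] allI impI)
  fix \<nu> r \<alpha> \<beta> \<sigma>min \<gamma> M p L stop x y \<theta> yre yt hmax fmin and \<epsilon>feas \<epsilon>dist \<eta> :: real
  assume exec: "main_execution \<Omega> d Y f h \<nu> r \<alpha> \<beta> \<sigma>min \<gamma> M p stop x y \<theta> yre yt"
    and bounded: "bounded_problem \<Omega> Y f h hmax fmin"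
    and \<epsilon>: "\<epsilon>feas > 0" "\<epsilon>dist > 0"
    and stop: "\<forall>k. \<forall>y'\<in>moa_candidates y yt k. h y' \<le> \<epsilon>feas \<longrightarrow>
      (\<forall>z\<in>\<Omega>. stop k y' z \<longrightarrow> critical \<Omega> d (M k y') (p k y') (L k y') \<eta> z)"
  let ?S = "infeasibility_bound f (x 0) (y 0) r (\<theta> 0) \<beta> hmax fmin"
  let ?T = "step_bound f \<alpha> (x 0) (y 0) r (\<theta> 0) \<beta> hmax fmin"
  interpret Metric_space \<Omega> d by fact
  note step = main_execution_step[OF assms exec]
  note sums = main_execution_sums[OF assms exec bounded]
  have "0 < \<nu>" using exec by (simp add: main_execution_def)
  have h_nonneg: "0 \<le> h (y k)" for k using step(2) assms(2) by blast
  \<comment> \<open>Feasibility is required at \<open>y (Suc k)\<close>, so the sum is shifted by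
    one; the omitted term \<open>h (y 0)\<close> is nonnegative.\<close>
  have "(\<Sum>k<n. h (y (Suc k))) \<le> ?S" for n
    using sums(1)[of "Suc n"] h_nonneg[of 0] by (simp add: sum.lessThan_Suc_shift del: sum.lessThan_Suc)
  then obtain k where k: "real k \<le> ?S / \<epsilon>feas + ?T / \<epsilon>dist powr \<nu>"
    "h (y (Suc k)) < \<epsilon>feas" "d (x k) (x (Suc k)) powr \<nu> < \<epsilon>dist powr \<nu>"
    using exists_small_both[of "\<lambda>k. h (y (Suc k))" "\<lambda>k. d (x k) (x (Suc k)) powr \<nu>"
        \<epsilon>feas "\<epsilon>dist powr \<nu>" ?S ?T] h_nonneg \<epsilon> sums(2) by auto
  \<comment> \<open>By contraposition: a longer step would have a \<open>\<nu>\<close>-th power of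
    at least \<open>\<epsilon>dist powr \<nu>\<close>.\<close>
  have "d (x k) (x (Suc k)) \<le> \<epsilon>dist"
    using k(3) \<open>0 < \<nu>\<close> \<epsilon> powr_mono2[of \<nu> \<epsilon>dist "d (x k) (x (Suc k))"]
    by (meson less_imp_le linorder_not_le)
  moreover have "critical \<Omega> d (M k (y (Suc k))) (p k (y (Suc k))) (L k (y (Suc k))) \<eta> (x (Suc k))"
    using stop k(2) step(1)[of "Suc k"] step(6)[of k] by (simp add: moa_candidates_def)
  ultimately show "\<exists>k. real k \<le> ?S / \<epsilon>feas + ?T / \<epsilon>dist powr \<nu> \<and>
      h (y (Suc k)) \<le> \<epsilon>feas \<and> d (x k) (x (Suc k)) \<le> \<epsilon>dist \<and>
      critical \<Omega> d (M k (y (Suc k))) (p k (y (Suc k))) (L k (y (Suc k))) \<eta> (x (Suc k))"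
    using k by auto
qed

end
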